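(* The sequences $\{\overline{SOME}(2n)\}_{n\ge 1}$ and $\{\overline{SOME}(2n-1)\}_{n\ge 1}$ are monotonically increasing (in the weak sense, i.e. each term is greater than or equal to the preceding one).
   Context: An overpartition of a positive integer $n$ is a partition of $n$ in which the first occurrence of each part size may be overlined. $\overline{SOME}(n)$ is the sum of all odd parts minus the sum of all even parts, taken over all overpartitions of $n$ (parts counted with multiplicity, overlined or not). *)

theory Defs
  imports Complex_Main "HOL-Library.Multiset"
begin

definition partitions :: "nat \<Rightarrow> nat multiset set" where
  "partitions n = {P. 0 \<notin># P \<and> \<Sum>\<^sub># P = n}"

text \<open>Since only the first occurrence of each part size may be overlined, an overpartition is
  determined by its underlying partition \<open>P\<close> and the set \<open>S\<close> of those part sizes
  whose first occurrence is overlined.\<close>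

definition overpartitions :: "nat \<Rightarrow> (nat multiset \<times> nat set) set" where
  "overpartitions n = {(P, S). P \<in> partitions n \<and> S \<subseteq> set_mset P}"

definition odd_minus_even_parts :: "nat multiset \<Rightarrow> int" where
  "odd_minus_even_parts P =
     int (\<Sum>\<^sub># (filter_mset odd P)) - int (\<Sum>\<^sub># (filter_mset even P))"

definition SOME_bar :: "nat \<Rightarrow> int" where
  "SOME_bar n = (\<Sum>(P, S)\<in>overpartitions n. odd_minus_even_parts P)"

text \<open>The sum defining \<^const>\<open>SOME_bar\<close> ranges over a finite set, so it is not
  subject to the convention that sums over infinite sets are \<open>0\<close>.\<close>

lemma size_le_sum_mset: "0 \<notin># P \<Longrightarrow> size P \<le> \<Sum>\<^sub># P" for P :: "nat multiset"
  by (induction P) (auto simp: Suc_le_eq)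

lemma finite_partitions: "finite (partitions n)"
proof (rule finite_subset)
  show "partitions n \<subseteq> mset ` {xs. set xs \<subseteq> {..n} \<and> length xs \<le> n}"
  proof
    fix P assume P: "P \<in> partitions n"
    obtain xs where xs: "mset xs = P"
      using ex_mset by blast
    have "length xs \<le> n"
      using P xs size_le_sum_mset[of P] by (auto simp: partitions_def)
    moreover have "set xs \<subseteq> {..n}"
      using P xs by (auto simp: partitions_def sum_mset_sum_list intro: member_le_sum_list)
    ultimately show "P \<in> mset ` {xs. set xs \<subseteq> {..n} \<and> length xs \<le> n}"
      using xs by auto
  qed
  show "finite (mset ` {xs. set xs \<subseteq> {..n} \<and> length xs \<le> n})"
    by (intro finite_imageI finite_lists_length_le) auto
qed

lemma finite_overpartitions: "finite (overpartitions n)"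
proof -
  have "overpartitions n = (SIGMA P:partitions n. Pow (set_mset P))"
    by (auto simp: overpartitions_def)
  then show ?thesis
    by (simp add: finite_partitions)
qed

end

theory Submission
  imports Defs "HOL-Computational_Algebra.Formal_Power_Series"
begin

text \<open>
  Put \<open>C k = (1 + q^k) / (1 - q^k)\<close> and let \<open>\<theta> = q d/dq\<close>. A part size \<open>k\<close> contributes the
  factor \<open>C k\<close> to the generating function of overpartitions, and weighting by the signed total of
  the parts equal to \<open>k\<close> replaces \<open>C k\<close> by \<open>\<plusminus> \<theta> (C k)\<close>, with sign \<open>+\<close> exactly for odd \<open>k\<close>. With
  \<open>\<phi> = (\<Prod>k odd. C k) / (\<Prod>k even. C k)\<close> the logarithmic derivative therefore
  gives the generating function \<open>\<theta> \<phi> \<cdot> (\<Prod>k even. C k)^2\<close> for the sums in question. By the Jacobi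
  triple product, \<open>\<phi> = \<Sum>j\<in>\<int>. q^(j^2)\<close> has nonnegative coefficients. Since
  \<open>(1 - q^2) C 2 = 1 + q^2\<close>, multiplying the generating function by \<open>1 - q^2\<close> gives
  nonnegative coefficients, which says that \<open>SOME_bar n \<le> SOME_bar (n + 2)\<close>. All infinite products are
  replaced by finite ones, which agree with them up to a sufficiently high power of \<open>q\<close>.
\<close>

section \<open>Gaussian binomials and a finite Jacobi triple product\<close>

fun qbinomial :: "'a::comm_ring_1 \<Rightarrow> nat \<Rightarrow> nat \<Rightarrow> 'a" where
  "qbinomial x n 0 = 1"
| "qbinomial x 0 (Suc k) = 0"
| "qbinomial x (Suc n) (Suc k) = qbinomial x n k + x ^ Suc k * qbinomial x n (Suc k)"

text \<open>The q-Pochhammer symbol \<open>(x; x)_n\<close>.\<close>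

definition qfact :: "'a::comm_ring_1 \<Rightarrow> nat \<Rightarrow> 'a" where
  "qfact x n = (\<Prod>i=1..n. 1 - x ^ i)"

lemma qfact_0 [simp]: "qfact x 0 = 1"
  by (simp add: qfact_def)

lemma qfact_Suc: "qfact x (Suc n) = qfact x n * (1 - x ^ Suc n)"
  by (simp add: qfact_def)

lemma qbinomial_eq_0: "n < k \<Longrightarrow> qbinomial x n k = 0"
  by (induction x n k rule: qbinomial.induct) auto

text \<open>The quotient formula with denominators cleared. The Pascal step rests on
  \<open>(1 - x^(k+1)) + x^(k+1) * (1 - x^(d+1)) = 1 - x^(n+1)\<close> for
  \<open>n = k + d + 1\<close>.\<close>

lemma qbinomial_qfact:
  "k \<le> n \<Longrightarrow> qbinomial x n k * qfact x k * qfact x (n - k) = qfact x n"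
proof (induction x n k rule: qbinomial.induct)
  case (3 x n k)
  show ?case
  proof (cases "k = n")
    case True
    with 3 show ?thesis by (simp add: qbinomial_eq_0 qfact_Suc mult.assoc[symmetric])
  next
    case False
    with 3 have kn: "Suc k \<le> n" by simp
    then obtain d where d: "n = Suc (k + d)" using less_iff_Suc_add[of k n] by auto
    have 1: "qbinomial x n k * qfact x k * qfact x (n - k) = qfact x n"
      and 2: "qbinomial x n (Suc k) * qfact x (Suc k) * qfact x (n - Suc k) = qfact x n"
      using "3.IH" kn by auto
    have e: "n - k = Suc d" "n - Suc k = d" using d by auto
    have "qbinomial x (Suc n) (Suc k) * qfact x (Suc k) * qfact x (Suc n - Suc k) =
        (qbinomial x n k * qfact x k * qfact x (n - k)) * (1 - x ^ Suc k)
      + x ^ Suc k * (qbinomial x n (Suc k) * qfact x (Suc k) * qfact x (n - Suc k)) * (1 - x ^ Suc d)"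
      by (simp add: e qfact_Suc algebra_simps)
    also have "\<dots> = qfact x n * (1 - x ^ Suc n)"
      unfolding 1 2 by (simp add: d algebra_simps power_add)
    finally show ?thesis by (simp add: qfact_Suc)
  qed
qed auto

text \<open>Splitting off the factor \<open>i = 0\<close> leaves the product for
  \<open>z * w^2\<close>, so the induction keeps \<open>z\<close> arbitrary.\<close>

lemma qbinomial_theorem:
  fixes w y z :: "'a::comm_ring_1"
  shows "(\<Prod>i<m. y + z * w ^ (2 * i + 1)) =
    (\<Sum>k\<le>m. qbinomial (w\<^sup>2) m k * w ^ k\<^sup>2 * z ^ k * y ^ (m - k))"
proof (induction m arbitrary: z)
  case 0
  then show ?case by simp
next
  case (Suc m)
  \<comment> \<open>\<open>T k\<close> is the term of the induction hypothesis at
    \<open>z * w^2\<close>, without its power of \<open>y\<close>; \<open>T_Suc\<close> is the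
    Pascal rule.\<close>
  define T where "T k = qbinomial (w\<^sup>2) m k * w ^ (k\<^sup>2 + 2 * k) * z ^ k" for k
  have T_Suc: "T (Suc k) + z * w * T k =
      qbinomial (w\<^sup>2) (Suc m) (Suc k) * w ^ (Suc k)\<^sup>2 * z ^ Suc k" for k
  proof -
    have "(w\<^sup>2) ^ Suc k = w ^ (2 * Suc k)" by (simp only: power_mult)
    moreover have "w ^ (Suc k)\<^sup>2 = w ^ (k\<^sup>2 + 2 * k) * w"
    proof -
      have "(Suc k)\<^sup>2 = k\<^sup>2 + 2 * k + 1" by (simp add: power2_eq_square)
      then show ?thesis by (simp only: power_add power_one_right)
    qed
    ultimately show ?thesis
      by (simp add: T_def power_add algebra_simps)
  qed
  have "(\<Prod>i<Suc m. y + z * w ^ (2 * i + 1)) =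
      (y + z * w) * (\<Prod>i<m. y + (z * w\<^sup>2) * w ^ (2 * i + 1))"
    by (subst prod.lessThan_Suc_shift) (simp add: mult.assoc power2_eq_square)
  also have "\<dots> = (y + z * w) * (\<Sum>k\<le>m. T k * y ^ (m - k))"
    unfolding Suc.IH T_def
    by (simp add: power_mult_distrib power_mult[symmetric] power_add mult_ac)
  also have "\<dots> = (\<Sum>k\<le>m. T k * y ^ (Suc m - k)) + (\<Sum>k\<le>m. z * w * T k * y ^ (m - k))"
    unfolding distrib_right sum_distrib_left sum.distrib
    by (intro arg_cong2[where f = "(+)"] sum.cong) (auto simp: Suc_diff_le mult_ac)
  also have "(\<Sum>k\<le>m. T k * y ^ (Suc m - k)) = (\<Sum>k\<le>Suc m. T k * y ^ (Suc m - k))"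
    by (simp add: T_def qbinomial_eq_0)
  also have "\<dots> = y ^ Suc m + (\<Sum>k\<le>m. T (Suc k) * y ^ (m - k))"
    by (subst sum.atMost_Suc_shift) (simp add: T_def)
  also have "\<dots> + (\<Sum>k\<le>m. z * w * T k * y ^ (m - k)) =
      y ^ Suc m + (\<Sum>k\<le>m. (T (Suc k) + z * w * T k) * y ^ (m - k))"
    by (simp add: sum.distrib distrib_right)
  also have "\<dots> = (\<Sum>k\<le>Suc m. qbinomial (w\<^sup>2) (Suc m) k * w ^ k\<^sup>2 * z ^ k * y ^ (Suc m - k))"
    unfolding T_Suc by (subst sum.atMost_Suc_shift) simp
  finally show ?case .
qed

text \<open>The \<open>q\<close>-binomial theorem for \<open>m = 2 n\<close>, \<open>w = X\<close>, \<open>z = 1\<close>, \<open>y = X^(2 n)\<close>: completing the square in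
  the exponents leaves a common factor \<open>X^(3 n^2)\<close> to cancel.\<close>

lemma finite_jacobi_triple_product:
  "(\<Prod>i<n. 1 + fps_X ^ (2 * i + 1))\<^sup>2 =
   (\<Sum>k\<le>2 * n. qbinomial (fps_X\<^sup>2) (2 * n) k * fps_X ^ nat ((int k - int n)\<^sup>2) :: 'a::idom fps)"
proof -
  let ?X = "fps_X :: 'a fps"
  let ?P = "\<Prod>i<n. 1 + ?X ^ (2 * i + 1)"
  have sq: "(\<Prod>i<n. ?X ^ (2 * i + 1)) = ?X ^ n\<^sup>2"
    by (induction n) (auto simp: power2_eq_square simp flip: power_add)
  \<comment> \<open>The factors with \<open>2 * i + 1 < 2 * n\<close> give up
    \<open>X^(2 * i + 1)\<close>, the others \<open>X^(2 * n)\<close>. Each half leaves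
    \<open>?P\<close>, the lower one in reverse order.\<close>
  have "(\<Prod>i<2 * n. ?X ^ (2 * n) + 1 * ?X ^ (2 * i + 1)) =
      (\<Prod>i<n. ?X ^ (2 * n) + ?X ^ (2 * i + 1)) * (\<Prod>i<n. ?X ^ (2 * n) + ?X ^ (2 * (n + i) + 1))"
    using prod.atLeastLessThan_concat[of 0 n "2 * n" "\<lambda>i. ?X ^ (2 * n) + ?X ^ (2 * i + 1)"]
      prod.shift_bounds_nat_ivl[of "\<lambda>i. ?X ^ (2 * n) + ?X ^ (2 * i + 1)" 0 n n]
    by (simp add: lessThan_atLeast0 mult_2 add_ac)
  also have "(\<Prod>i<n. ?X ^ (2 * n) + ?X ^ (2 * (n + i) + 1)) = ?X ^ (2 * n\<^sup>2) * ?P"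
  proof -
    have "(\<Prod>i<n. ?X ^ (2 * n) + ?X ^ (2 * (n + i) + 1)) = (\<Prod>i<n. ?X ^ (2 * n) * (1 + ?X ^ (2 * i + 1)))"
      by (intro prod.cong) (auto simp: algebra_simps power_add)
    also have "\<dots> = ?X ^ (2 * n\<^sup>2) * ?P"
      unfolding prod.distrib by (simp add: power_mult[symmetric] power2_eq_square mult_ac)
    finally show ?thesis .
  qed
  also have "(\<Prod>i<n. ?X ^ (2 * n) + ?X ^ (2 * i + 1)) = ?X ^ n\<^sup>2 * ?P"
  proof -
    have "(\<Prod>i<n. ?X ^ (2 * n) + ?X ^ (2 * i + 1)) =
        (\<Prod>i<n. ?X ^ (2 * i + 1) * (1 + ?X ^ (2 * (n - Suc i) + 1)))"
    proof (intro prod.cong refl)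
      fix i assume "i \<in> {..<n}"
      then have "2 * n = (2 * i + 1) + (2 * (n - Suc i) + 1)" by auto
      then have "?X ^ (2 * n) = ?X ^ (2 * i + 1) * ?X ^ (2 * (n - Suc i) + 1)"
        by (metis power_add)
      then show "?X ^ (2 * n) + ?X ^ (2 * i + 1) = ?X ^ (2 * i + 1) * (1 + ?X ^ (2 * (n - Suc i) + 1))"
        by (simp only: distrib_left mult_1_right add.commute)
    qed
    also have "\<dots> = ?X ^ n\<^sup>2 * ?P"
      unfolding prod.distrib sq
      using prod.nat_diff_reindex[of "\<lambda>i. 1 + ?X ^ (2 * i + 1)" n] by simp
    finally show ?thesis .
  qed
  also have "?X ^ n\<^sup>2 * ?P * (?X ^ (2 * n\<^sup>2) * ?P) = ?X ^ (3 * n\<^sup>2) * ?P\<^sup>2"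
  proof -
    have "?X ^ (3 * n\<^sup>2) = ?X ^ n\<^sup>2 * ?X ^ (2 * n\<^sup>2)" by (simp flip: power_add)
    moreover have "a * p * (b * p) = a * b * p\<^sup>2" for a b p :: "'a fps"
      by (simp add: power2_eq_square mult_ac)
    ultimately show ?thesis by metis
  qed
  finally have "?X ^ (3 * n\<^sup>2) * ?P\<^sup>2 = (\<Prod>i<2 * n. ?X ^ (2 * n) + 1 * ?X ^ (2 * i + 1))"
    by (rule sym)
  also have "\<dots> = (\<Sum>k\<le>2 * n. qbinomial (?X\<^sup>2) (2 * n) k * ?X ^ k\<^sup>2 * 1 ^ k * (?X ^ (2 * n)) ^ (2 * n - k))"
    by (rule qbinomial_theorem)
  also have "\<dots> = ?X ^ (3 * n\<^sup>2) * (\<Sum>k\<le>2 * n. qbinomial (?X\<^sup>2) (2 * n) k * ?X ^ nat ((int k - int n)\<^sup>2))"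
    unfolding sum_distrib_left
  proof (intro sum.cong refl)
    fix k assume k: "k \<in> {..2 * n}"
    have "int (k\<^sup>2 + 2 * n * (2 * n - k)) = int (3 * n\<^sup>2 + nat ((int k - int n)\<^sup>2))"
    proof -
      have "int (2 * n - k) = 2 * int n - int k" using k by simp
      then have "int (k\<^sup>2 + 2 * n * (2 * n - k)) = (int k)\<^sup>2 + 2 * int n * (2 * int n - int k)"
        by (simp only: of_nat_add of_nat_mult of_nat_power of_nat_numeral)
      also have "\<dots> = 3 * (int n)\<^sup>2 + (int k - int n)\<^sup>2"
        by (simp add: power2_eq_square algebra_simps)
      finally show ?thesis by simp
    qed
    then have "k\<^sup>2 + 2 * n * (2 * n - k) = 3 * n\<^sup>2 + nat ((int k - int n)\<^sup>2)"
      by linarith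
    then have "?X ^ k\<^sup>2 * (?X ^ (2 * n)) ^ (2 * n - k) = ?X ^ (3 * n\<^sup>2) * ?X ^ nat ((int k - int n)\<^sup>2)"
      by (simp flip: power_mult power_add)
    then show "qbinomial (?X\<^sup>2) (2 * n) k * ?X ^ k\<^sup>2 * 1 ^ k * (?X ^ (2 * n)) ^ (2 * n - k) =
      ?X ^ (3 * n\<^sup>2) * (qbinomial (?X\<^sup>2) (2 * n) k * ?X ^ nat ((int k - int n)\<^sup>2))"
      by (simp add: mult_ac)
  qed
  finally show ?thesis by simp
qed

section \<open>Congruences modulo powers of X\<close>

text \<open>Divisibility of a difference by \<open>fps_X ^ r\<close> expresses congruence modulo
  \<open>fps_X ^ r\<close>; in this sense tails of products may be replaced by 1.\<close>

lemma fps_X_power_dvd_prod_minus_1: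
  assumes "finite A" "\<And>i. i \<in> A \<Longrightarrow> r \<le> f i"
  shows "(fps_X :: 'a::comm_ring_1 fps) ^ r dvd (\<Prod>i\<in>A. 1 - fps_X ^ f i) - 1"
  using assms
proof (induction A rule: finite_induct)
  case (insert a A)
  have "(\<Prod>i\<in>insert a A. 1 - fps_X ^ f i) - 1 =
      ((\<Prod>i\<in>A. 1 - fps_X ^ f i) - 1) - fps_X ^ f a * (\<Prod>i\<in>A. 1 - (fps_X :: 'a fps) ^ f i)"
    using insert.hyps by (simp add: algebra_simps)
  also have "fps_X ^ r dvd \<dots>"
    using insert by (intro dvd_diff[OF insert.IH] dvd_mult2 le_imp_power_dvd) auto
  finally show ?case .
qed simp

lemma fps_nth_eq_if_X_power_dvd:
  fixes f g :: "'a::comm_ring_1 fps"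
  assumes "fps_X ^ r dvd f - g" "i < r"
  shows "fps_nth f i = fps_nth g i"
proof -
  obtain h where "f - g = fps_X ^ r * h" using assms(1) by (elim dvdE)
  then have "fps_nth (f - g) i = 0" using assms(2) by (simp add: fps_X_power_mult_nth)
  then show ?thesis by simp
qed

lemma qfact_mult_prod: "m \<le> n \<Longrightarrow> qfact x n = qfact x m * (\<Prod>i\<in>{m<..n}. 1 - x ^ i)"
  unfolding qfact_def
  by (subst prod.union_disjoint[symmetric]) (auto intro!: prod.cong)

lemma one_minus_fps_X_power_nonzero: "k > 0 \<Longrightarrow> (1 - fps_X ^ k :: 'a::idom fps) \<noteq> 0"
  by (auto dest!: arg_cong[where f = "\<lambda>f. fps_nth f 0"])

lemma qfact_fps_X_nonzero: "qfact ((fps_X :: 'a::idom fps)\<^sup>2) n \<noteq> 0"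
  using one_minus_fps_X_power_nonzero[where 'a = 'a]
  by (auto simp: qfact_def prod_zero_iff simp del: right_minus_eq simp flip: power_mult)

text \<open>For \<open>d = \<bar>k - n\<bar>\<close> \<open>qfact\<close> times \<open>qbinomial\<close> is a product of terms \<open>1 - X^(2 i)\<close> with \<open>i > n - d\<close>, so the error
  has order at least \<open>d^2 + 2 (n - d) + 2 = (d - 1)^2 + 2 n + 1\<close>.\<close>

lemma X_power_dvd_qfact_mult_qbinomial:
  assumes "k \<le> 2 * n"
  shows "(fps_X :: 'a::idom fps) ^ (2 * n + 1) dvd
    qfact (fps_X\<^sup>2) n * (qbinomial (fps_X\<^sup>2) (2 * n) k * fps_X ^ nat ((int k - int n)\<^sup>2))
    - fps_X ^ nat ((int k - int n)\<^sup>2)"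
proof -
  let ?X = "fps_X :: 'a fps"
  let ?Q = "?X\<^sup>2"
  define d where "d = nat \<bar>int k - int n\<bar>"
  have dn: "d \<le> n" using assms by (auto simp: d_def)
  have d2: "nat ((int k - int n)\<^sup>2) = d\<^sup>2"
    by (simp add: d_def flip: nat_power_eq)
  \<comment> \<open>By the symmetry between \<open>k\<close> and \<open>2 * n - k\<close> only
    \<open>d\<close> matters.\<close>
  have "(k = n + d \<and> 2 * n - k = n - d) \<or> (k = n - d \<and> 2 * n - k = n + d)"
    using assms by (auto simp: d_def)
  then have b: "qbinomial ?Q (2 * n) k * qfact ?Q (n + d) * qfact ?Q (n - d) = qfact ?Q (2 * n)"
    using qbinomial_qfact[OF assms, of ?Q] by (auto simp: mult_ac)
  let ?A = "\<Prod>i\<in>{n - d<..n}. 1 - ?X ^ (2 * i)"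
  let ?B = "\<Prod>i\<in>{n + d<..2 * n}. 1 - ?X ^ (2 * i)"
  have A: "qfact ?Q n = qfact ?Q (n - d) * ?A"
    using qfact_mult_prod[of "n - d" n ?Q] by (simp add: power_mult)
  have B: "qfact ?Q (2 * n) = qfact ?Q (n + d) * ?B"
    using qfact_mult_prod[of "n + d" "2 * n" ?Q] dn by (simp add: power_mult)
  have "qfact ?Q (n + d) * (qfact ?Q n * qbinomial ?Q (2 * n) k) = qfact ?Q (n + d) * (?A * ?B)"
  proof -
    have "c * x * y = x * e \<Longrightarrow> x * (y * a * c) = x * (a * e)" for a c e x y :: "'a fps"
      by (metis mult.assoc mult.commute mult.left_commute)
    then show ?thesis using b unfolding A B by blast
  qed
  then have AB: "qfact ?Q n * qbinomial ?Q (2 * n) k = ?A * ?B"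
    using qfact_fps_X_nonzero by (metis mult_left_cancel)
  \<comment> \<open>The sum on the right is \<open>?A * ?B - 1\<close>, and all exponents in
    \<open>?A\<close> and \<open>?B\<close> are at least \<open>2 * (n - d) + 2\<close>.\<close>
  have "?X ^ (2 * (n - d) + 2) dvd (?A - 1) * ?B + (?B - 1)"
    by (intro dvd_add dvd_mult2 fps_X_power_dvd_prod_minus_1) auto
  then have dvd: "?X ^ (d\<^sup>2 + (2 * (n - d) + 2)) dvd ?X ^ d\<^sup>2 * ((?A - 1) * ?B + (?B - 1))"
    unfolding power_add[of ?X "d\<^sup>2"] by (rule mult_dvd_mono[OF dvd_refl])
  have le: "2 * n + 1 \<le> d\<^sup>2 + (2 * (n - d) + 2)"
  proof -
    have "0 \<le> (int d - 1)\<^sup>2" by simp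
    then have "int (2 * n + 1) \<le> int (d\<^sup>2 + (2 * (n - d) + 2))"
      using dn by (simp add: of_nat_diff power2_eq_square algebra_simps)
    then show ?thesis by linarith
  qed
  have "?X ^ d\<^sup>2 * ((?A - 1) * ?B + (?B - 1)) =
      (qfact ?Q n * qbinomial ?Q (2 * n) k) * ?X ^ d\<^sup>2 - ?X ^ d\<^sup>2"
    unfolding AB by (simp add: algebra_simps)
  with dvd_trans[OF le_imp_power_dvd[OF le] dvd] show ?thesis
    unfolding d2 by (simp only: mult.assoc)
qed

section \<open>Nonnegativity of \<phi> up to a given order\<close>

text \<open>As a series in the total of the parts equal to \<open>k\<close>, this is
  \<open>1 + 2 X^k + 2 X^(2k) + ...\<close>: if \<open>k\<close> occurs, its first occurrence is
  overlined or not.\<close>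

definition opfactor :: "nat \<Rightarrow> real fps" where
  "opfactor k = (1 + fps_X ^ k) / (1 - fps_X ^ k)"

lemma opfactor_mult: "k > 0 \<Longrightarrow> opfactor k * (1 - fps_X ^ k) = 1 + fps_X ^ k"
  unfolding opfactor_def
  by (subst fps_divide_unit) (auto simp: mult.assoc inverse_mult_eq_1)

lemma opfactor_nth:
  assumes "k > 0"
  shows "fps_nth (opfactor k) i = (if i = 0 then 1 else if k dvd i then 2 else 0)"
proof -
  let ?g = "Abs_fps (\<lambda>i. if i = 0 then 1 else if k dvd i then 2 else (0::real))"
  have "?g * (1 - fps_X ^ k) = 1 + fps_X ^ k"
  proof (rule fps_ext)
    fix i
    have "k dvd i \<longleftrightarrow> k dvd i - k" if "k \<le> i"
      using that by (simp add: dvd_minus_self)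
    then show "fps_nth (?g * (1 - fps_X ^ k)) i = fps_nth (1 + fps_X ^ k) i"
      using assms by (auto simp: right_diff_distrib fps_X_power_mult_right_nth dest: dvd_imp_le)
  qed
  then have "?g = opfactor k"
    using opfactor_mult[OF assms] one_minus_fps_X_power_nonzero[OF assms]
    by (metis mult_right_cancel)
  from this[symmetric] show ?thesis by simp
qed


text \<open>Truncation of \<phi>. Inverting an even factor reverses the sign of its logarithmic
  derivative.\<close>

definition signed_opproduct :: "nat \<Rightarrow> real fps" where
  "signed_opproduct N = (\<Prod>k=1..N. if odd k then opfactor k else inverse (opfactor k))"

definition even_opproduct :: "nat \<Rightarrow> real fps" where
  "even_opproduct N = (\<Prod>k=1..N. if even k then opfactor k else 1)"

lemma signed_opproduct_Suc:
  "signed_opproduct (Suc N) =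
    signed_opproduct N * (if odd (Suc N) then opfactor (Suc N) else inverse (opfactor (Suc N)))"
  by (simp add: signed_opproduct_def)

lemma even_opproduct_Suc:
  "even_opproduct (Suc N) = even_opproduct N * (if even (Suc N) then opfactor (Suc N) else 1)"
  by (simp add: even_opproduct_def)

lemma inverse_opfactor_mult: "k > 0 \<Longrightarrow> inverse (opfactor k) * opfactor k = 1"
  by (rule inverse_mult_eq_1) (simp add: opfactor_nth)

lemma inverse_opfactor_mult': "k > 0 \<Longrightarrow> inverse (opfactor k) * (1 + fps_X ^ k) = 1 - fps_X ^ k"
  using inverse_opfactor_mult[of k] by (simp add: mult.assoc[symmetric] flip: opfactor_mult)

text \<open>Clears the denominators of \<phi>. As \<open>qfact\<close> has base \<open>X^2\<close>,
  its new factors are \<open>1 - a * a\<close> and \<open>1 - b * b\<close>; they turn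
  \<open>(1 + a) / (1 - a)\<close> into \<open>(1 + a)^2\<close> and
  \<open>(1 - b) / (1 + b)\<close> into \<open>(1 - b)^2\<close>.\<close>

lemma signed_opproduct_qfact:
  "signed_opproduct (2 * n) * qfact (fps_X\<^sup>2) (2 * n) =
   (qfact (fps_X\<^sup>2) n)\<^sup>2 * (\<Prod>i<n. 1 + fps_X ^ (2 * i + 1))\<^sup>2"
proof (induction n)
  case 0
  then show ?case by (simp add: signed_opproduct_def)
next
  case (Suc n)
  let ?Q = "(fps_X :: real fps)\<^sup>2"
  define a b where "a = (fps_X :: real fps) ^ (2 * n + 1)" and "b = (fps_X :: real fps) ^ (2 * n + 2)"
  define F where "F = signed_opproduct (2 * n) * qfact ?Q (2 * n)"
  have aa: "?Q ^ Suc (2 * n) = a * a" and bb: "?Q ^ Suc (Suc (2 * n)) = b * b" and b': "?Q ^ Suc n = b"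
    by (simp_all add: a_def b_def power_mult[symmetric] mult_2 flip: power_add)
  have 1: "opfactor (Suc (2 * n)) * (1 - a) = 1 + a"
    and 2: "inverse (opfactor (Suc (Suc (2 * n)))) * (1 + b) = 1 - b"
    using opfactor_mult[of "Suc (2 * n)"] inverse_opfactor_mult'[of "Suc (Suc (2 * n))"]
    by (simp_all add: a_def b_def)
  have "signed_opproduct (2 * Suc n) * qfact ?Q (2 * Suc n) =
      F * (opfactor (Suc (2 * n)) * (1 - a)) * (1 + a) *
      (inverse (opfactor (Suc (Suc (2 * n)))) * (1 + b)) * (1 - b)"
  proof -
    have eq: "f * o1 * o2 * (q * (1 - a * a) * (1 - b * b)) =
        f * q * (o1 * (1 - a)) * (1 + a) * (o2 * (1 + b)) * (1 - b)"
      for f o1 o2 q :: "real fps"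
      by (simp add: algebra_simps)
    show ?thesis
      unfolding F_def mult_Suc_right add_2_eq_Suc signed_opproduct_Suc qfact_Suc aa bb eq[symmetric]
      by simp
  qed
  also have "\<dots> = F * (1 + a)\<^sup>2 * (1 - b)\<^sup>2"
    unfolding 1 2 by (simp add: power2_eq_square mult_ac)
  also have "\<dots> = (qfact ?Q (Suc n))\<^sup>2 * (\<Prod>i<Suc n. 1 + fps_X ^ (2 * i + 1))\<^sup>2"
    unfolding F_def Suc.IH qfact_Suc b' by (simp add: a_def power_mult_distrib mult_ac)
  finally show ?case .
qed

text \<open>Modulo \<open>X^(2 * n + 1)\<close> the product agrees with the theta sum of
  \<open>X^(j^2)\<close> over \<open>\<bar>j\<bar> \<le> n\<close>, whence the range of
  \<open>i\<close>.\<close>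

lemma signed_opproduct_nth_nonneg:
  assumes "i \<le> 2 * n"
  shows "fps_nth (signed_opproduct (2 * n)) i \<ge> 0"
proof -
  let ?Q = "(fps_X :: real fps)\<^sup>2"
  let ?f = "signed_opproduct (2 * n)"
  let ?D = "\<Prod>k\<in>{n<..2 * n}. 1 - (fps_X :: real fps) ^ (2 * k)"
  let ?S = "\<Sum>k\<le>2 * n. (fps_X :: real fps) ^ nat ((int k - int n)\<^sup>2)"
  have D: "qfact ?Q (2 * n) = qfact ?Q n * ?D"
    using qfact_mult_prod[of n "2 * n" ?Q] by (simp add: power_mult)
  have "qfact ?Q n * (?f * ?D) = qfact ?Q n * (qfact ?Q n * (\<Prod>i<n. 1 + fps_X ^ (2 * i + 1))\<^sup>2)"
  proof -
    have "f * (q * d) = q\<^sup>2 * p \<Longrightarrow> q * (f * d) = q * (q * p)" for f q d p :: "real fps"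
      by (simp add: power2_eq_square mult_ac)
    then show ?thesis using signed_opproduct_qfact[of n] unfolding D by blast
  qed
  then have "?f * ?D = qfact ?Q n * (\<Prod>i<n. 1 + fps_X ^ (2 * i + 1))\<^sup>2"
    using qfact_fps_X_nonzero by (metis mult_left_cancel)
  also have "\<dots> = (\<Sum>k\<le>2 * n. qfact ?Q n * (qbinomial ?Q (2 * n) k * fps_X ^ nat ((int k - int n)\<^sup>2)))"
    unfolding finite_jacobi_triple_product sum_distrib_left ..
  finally have "?f * ?D - ?S = (\<Sum>k\<le>2 * n. qfact ?Q n * (qbinomial ?Q (2 * n) k *
      fps_X ^ nat ((int k - int n)\<^sup>2)) - fps_X ^ nat ((int k - int n)\<^sup>2))"
    by (simp add: sum_subtractf)
  also have "fps_X ^ (2 * n + 1) dvd \<dots>"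
    by (intro dvd_sum X_power_dvd_qfact_mult_qbinomial) auto
  \<comment> \<open>\<open>?D\<close> is 1 modulo \<open>X^(2 * n + 1)\<close>, so
    \<open>?f * ?D\<close> may be replaced by \<open>?f\<close>.\<close>
  finally have "fps_X ^ (2 * n + 1) dvd (?f * ?D - ?S) - ?f * (?D - 1)"
    by (rule dvd_diff[OF _ dvd_mult[OF fps_X_power_dvd_prod_minus_1]]) auto
  then have "fps_X ^ (2 * n + 1) dvd ?f - ?S"
    by (simp add: algebra_simps)
  then have "fps_nth ?f i = fps_nth ?S i"
    by (rule fps_nth_eq_if_X_power_dvd) (use assms in simp)
  then show ?thesis
    by (simp add: fps_sum_nth sum_nonneg)
qed

section \<open>Generating functions for bounded parts\<close>

text \<open>Set up for induction on the bound, which brings in one factor \<open>opfactor\<close> at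
  a time.\<close>

definition parts_le :: "nat \<Rightarrow> nat \<Rightarrow> nat multiset set" where
  "parts_le N n = {P \<in> partitions n. \<forall>k\<in>#P. k \<le> N}"

lemma finite_parts_le: "finite (parts_le N n)"
  by (simp add: parts_le_def finite_partitions)

lemma parts_le_eq_partitions: "n \<le> N \<Longrightarrow> parts_le N n = partitions n"
  by (fastforce simp: parts_le_def partitions_def dest: multi_member_split)

text \<open>Here \<open>i\<close> is the total of the parts equal to \<open>Suc N\<close>. Letting
  it run over \<open>0..n\<close> with a divisibility test gives the sum the shape of a Cauchy
  product.\<close>

lemma sum_parts_le_Suc:
  "(\<Sum>P\<in>parts_le (Suc N) n. h P) =
   (\<Sum>i=0..n. if Suc N dvd i
     then \<Sum>P\<in>parts_le N (n - i). h (P + replicate_mset (i div Suc N) (Suc N)) else 0)"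
proof -
  let ?K = "Suc N"
  let ?I = "{i \<in> {0..n}. ?K dvd i}"
  let ?g = "\<lambda>(i, P). P + replicate_mset (i div ?K) ?K"
  have split: "filter_mset (\<lambda>k. k \<noteq> ?K) P + replicate_mset (count P ?K) ?K = P" for P
    by (metis add.commute filter_eq_replicate_mset multiset_partition)
  have "(\<Sum>P\<in>parts_le ?K n. h P) = (\<Sum>x\<in>(SIGMA i:?I. parts_le N (n - i)). h (?g x))"
  proof (rule sum.reindex_bij_witness[where j = "\<lambda>P. (?K * count P ?K, filter_mset (\<lambda>k. k \<noteq> ?K) P)" and i = ?g])
    fix P assume P: "P \<in> parts_le ?K n"
    show "?g (?K * count P ?K, filter_mset (\<lambda>k. k \<noteq> ?K) P) = P"
      using split[of P] by (simp del: mult_Suc)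
    then show "h (?g (?K * count P ?K, filter_mset (\<lambda>k. k \<noteq> ?K) P)) = h P" by simp
    have "\<Sum>\<^sub># (filter_mset (\<lambda>k. k \<noteq> ?K) P) + ?K * count P ?K = n"
      using arg_cong[OF split[of P], of sum_mset] P
      by (simp add: parts_le_def partitions_def mult.commute del: mult_Suc mult_Suc_right)
    then show "(?K * count P ?K, filter_mset (\<lambda>k. k \<noteq> ?K) P) \<in> (SIGMA i:?I. parts_le N (n - i))"
      using P by (auto simp: parts_le_def partitions_def le_Suc_eq simp del: mult_Suc)
  next
    fix x assume x: "x \<in> (SIGMA i:?I. parts_le N (n - i))"
    obtain i P where [simp]: "x = (i, P)" by (cases x)
    have i: "i \<le> n" "?K dvd i" and P: "P \<in> partitions (n - i)" "\<forall>k\<in>#P. k \<le> N"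
      using x by (auto simp: parts_le_def)
    have "?K \<notin># P" using P(2) by auto
    then have "count P ?K = 0" by (simp add: not_in_iff)
    moreover have "filter_mset (\<lambda>k. k \<noteq> ?K) P = P"
      using \<open>?K \<notin># P\<close> by (auto simp: filter_mset_eq_conv)
    ultimately show "(?K * count (?g x) ?K, filter_mset (\<lambda>k. k \<noteq> ?K) (?g x)) = x"
      using i by (simp del: mult_Suc)
    show "?g x \<in> parts_le ?K n"
      using i P by (auto simp: parts_le_def partitions_def simp del: mult_Suc_right)
  qed
  also have "\<dots> = (\<Sum>i\<in>?I. \<Sum>P\<in>parts_le N (n - i). h (P + replicate_mset (i div ?K) ?K))"
    by (subst sum.Sigma) (auto simp: finite_parts_le case_prod_unfold)
  also have "\<dots> = (\<Sum>i=0..n. if ?K dvd i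
     then \<Sum>P\<in>parts_le N (n - i). h (P + replicate_mset (i div ?K) ?K) else 0)"
    by (rule sum.inter_filter) simp
  finally show ?thesis .
qed

text \<open>The number of overpartitions with underlying partition \<open>P\<close>, real-valued to
  match the coefficients of the series.\<close>

definition opcount :: "nat multiset \<Rightarrow> real" where
  "opcount P = 2 ^ card (set_mset P)"

lemma odd_minus_even_parts_add_replicate:
  "odd_minus_even_parts (P + replicate_mset j k) =
    odd_minus_even_parts P + (if odd k then 1 else - 1) * int (j * k)"
  by (induction j) (auto simp: odd_minus_even_parts_def algebra_simps)

lemma opcount_add_replicate:
  "k \<notin># P \<Longrightarrow> opcount (P + replicate_mset j k) = (if j = 0 then 1 else 2) * opcount P"
  by (auto simp: opcount_def)

lemma opcount_add_replicate_parts_le: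
  assumes "P \<in> parts_le N m" "Suc N dvd i"
  shows "opcount (P + replicate_mset (i div Suc N) (Suc N)) = fps_nth (opfactor (Suc N)) i * opcount P"
proof -
  have "Suc N \<notin># P" using assms by (auto simp: parts_le_def)
  then show ?thesis
    using assms(2) by (auto simp: opcount_add_replicate opfactor_nth div_eq_0_iff dest: dvd_imp_le)
qed

lemma parts_le_0: "parts_le 0 n = (if n = 0 then {{#}} else {})"
proof -
  have "P = {#}" if "P \<in> parts_le 0 n" for P
    using that by (cases P) (auto simp: parts_le_def partitions_def)
  moreover have "{#} \<in> parts_le 0 n \<longleftrightarrow> n = 0"
    by (auto simp: parts_le_def partitions_def)
  ultimately show ?thesis
    by auto
qed

text \<open>The square restores the even factors, as \<open>C^-1 * C^2 = C\<close>.\<close>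

lemma sum_opcount:
  "(\<Sum>P\<in>parts_le N n. opcount P) = fps_nth (signed_opproduct N * (even_opproduct N)\<^sup>2) n"
proof (induction N arbitrary: n)
  case 0
  show ?case by (simp add: parts_le_0 opcount_def signed_opproduct_def even_opproduct_def)
next
  case (Suc N)
  let ?C = "opfactor (Suc N)"
  let ?A = "signed_opproduct N * (even_opproduct N)\<^sup>2"
  have "(\<Sum>P\<in>parts_le (Suc N) n. opcount P) = (\<Sum>i=0..n. fps_nth ?C i * fps_nth ?A (n - i))"
    unfolding sum_parts_le_Suc
    by (intro sum.cong)
      (auto simp: opfactor_nth opcount_add_replicate_parts_le Suc.IH simp flip: sum_distrib_left)
  also have "\<dots> = fps_nth (?C * ?A) n"
    by (simp add: fps_mult_nth)
  also have "?C * ?A = signed_opproduct (Suc N) * (even_opproduct (Suc N))\<^sup>2"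
    using inverse_opfactor_mult[of "Suc N"]
    by (simp add: signed_opproduct_Suc even_opproduct_Suc power2_eq_square algebra_simps)
  finally show ?case .
qed

text \<open>Adjoining parts \<open>Suc N\<close> of total \<open>i\<close> changes the weight by
  \<open>s * i\<close>, and \<open>fps_XD\<close> multiplies coefficient \<open>i\<close> by
  \<open>i\<close>. Hence \<open>?W\<close> becomes \<open>?C * ?W + s * fps_XD ?C * ?A\<close>, to
  be matched with the product rule.\<close>

lemma sum_odd_minus_even_parts:
  "(\<Sum>P\<in>parts_le N n. opcount P * of_int (odd_minus_even_parts P)) =
    fps_nth (fps_XD (signed_opproduct N) * (even_opproduct N)\<^sup>2) n"
proof (induction N arbitrary: n)
  case 0
  show ?case by (simp add: parts_le_0 odd_minus_even_parts_def signed_opproduct_def fps_XD_def)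
next
  case (Suc N)
  let ?C = "opfactor (Suc N)"
  let ?\<phi> = "signed_opproduct N" and ?E = "even_opproduct N"
  let ?A = "?\<phi> * ?E\<^sup>2" and ?W = "fps_XD ?\<phi> * ?E\<^sup>2"
  define s :: real where "s = (if odd (Suc N) then 1 else - 1)"
  have inner: "(\<Sum>P\<in>parts_le N m. opcount (P + replicate_mset (i div Suc N) (Suc N)) *
        of_int (odd_minus_even_parts (P + replicate_mset (i div Suc N) (Suc N)))) =
      fps_nth ?C i * fps_nth ?W m + s * (of_nat i * fps_nth ?C i) * fps_nth ?A m"
    if "Suc N dvd i" for i m
  proof -
    have "opcount (P + replicate_mset (i div Suc N) (Suc N)) *
        of_int (odd_minus_even_parts (P + replicate_mset (i div Suc N) (Suc N))) =
      fps_nth ?C i * (opcount P * of_int (odd_minus_even_parts P)) +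
      s * (of_nat i * fps_nth ?C i) * opcount P" if "P \<in> parts_le N m" for P
      unfolding opcount_add_replicate_parts_le[OF that \<open>Suc N dvd i\<close>] odd_minus_even_parts_add_replicate
        dvd_div_mult_self[OF \<open>Suc N dvd i\<close>]
      by (simp add: s_def algebra_simps)
    then show ?thesis
      by (simp add: sum.distrib Suc.IH sum_opcount flip: sum_distrib_left)
  qed
  have "(\<Sum>P\<in>parts_le (Suc N) n. opcount P * of_int (odd_minus_even_parts P)) =
    (\<Sum>i=0..n. fps_nth ?C i * fps_nth ?W (n - i) + s * (of_nat i * fps_nth ?C i) * fps_nth ?A (n - i))"
    unfolding sum_parts_le_Suc by (intro sum.cong) (auto simp: inner opfactor_nth)
  also have "\<dots> = fps_nth (?C * ?W + fps_const s * (fps_XD ?C * ?A)) n"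
    by (simp only: fps_add_nth fps_mult_left_const_nth fps_mult_nth[of ?C ?W]
        fps_mult_nth[of "fps_XD ?C" ?A] fps_XD_nth sum.distrib sum_distrib_left mult.assoc)
  also have "?C * ?W + fps_const s * (fps_XD ?C * ?A) =
      fps_XD (signed_opproduct (Suc N)) * (even_opproduct (Suc N))\<^sup>2"
  proof (cases "odd (Suc N)")
    case True
    then show ?thesis
      by (simp add: s_def signed_opproduct_Suc even_opproduct_Suc fps_XD_def algebra_simps)
  next
    case False
    let ?D = "inverse ?C"
    have DC: "?D * ?C = 1" by (rule inverse_opfactor_mult) simp
    \<comment> \<open>Differentiating \<open>?D * ?C = 1\<close> produces the minus sign of the even
      parts.\<close>
    have "fps_XD (?D * ?C) = 0" unfolding DC by (simp add: fps_XD_def)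
    then have "fps_XD ?D * ?C + ?D * fps_XD ?C = 0"
      by (simp add: fps_XD_def algebra_simps)
    then have XD: "fps_XD ?D * ?C = - (?D * fps_XD ?C)" by (simp add: eq_neg_iff_add_eq_0)
    have "fps_XD (signed_opproduct (Suc N)) * (even_opproduct (Suc N))\<^sup>2 =
      (fps_XD ?\<phi> * (?D * ?C) + ?\<phi> * (fps_XD ?D * ?C)) * ?C * ?E\<^sup>2"
      using False
      by (simp add: signed_opproduct_Suc even_opproduct_Suc fps_XD_def power2_eq_square algebra_simps)
    also have "\<dots> = fps_XD ?\<phi> * ?C * ?E\<^sup>2 - ?\<phi> * fps_XD ?C * ?E\<^sup>2"
    proof -
      have "\<dots> = fps_XD ?\<phi> * (?D * ?C) * ?C * ?E\<^sup>2 - ?\<phi> * fps_XD ?C * (?D * ?C) * ?E\<^sup>2"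
        unfolding XD by (simp add: algebra_simps)
      then show ?thesis by (simp add: DC)
    qed
    finally show ?thesis
      using False fps_const_neg[of "1 :: real", symmetric] by (simp add: s_def algebra_simps del: fps_const_neg)
  qed
  finally show ?case .
qed

text \<open>The weight ignores the overlined set, so \<open>P\<close> is counted
  \<open>opcount P\<close> times; no part of a partition of \<open>n\<close> exceeds
  \<open>N\<close>.\<close>

lemma SOME_bar_eq:
  assumes "n \<le> N"
  shows "of_int (SOME_bar n) = fps_nth (fps_XD (signed_opproduct N) * (even_opproduct N)\<^sup>2) n"
proof -
  have "overpartitions n = (SIGMA P:partitions n. Pow (set_mset P))"
    by (auto simp: overpartitions_def)
  then have "SOME_bar n = (\<Sum>P\<in>partitions n. \<Sum>S\<in>Pow (set_mset P). odd_minus_even_parts P)"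
    unfolding SOME_bar_def by (subst sum.Sigma) (auto simp: finite_partitions)
  then show ?thesis
    by (simp add: card_Pow opcount_def parts_le_eq_partitions[OF assms] flip: sum_odd_minus_even_parts)
qed

section \<open>Monotonicity in steps of two\<close>

lemma fps_mult_nth_nonneg:
  fixes f g :: "'a::linordered_semidom fps"
  assumes "\<And>i. i \<le> n \<Longrightarrow> fps_nth f i \<ge> 0" "\<And>i. i \<le> n \<Longrightarrow> fps_nth g i \<ge> 0"
  shows "fps_nth (f * g) n \<ge> 0"
  unfolding fps_mult_nth using assms by (intro sum_nonneg mult_nonneg_nonneg) auto

text \<open>The square contains \<open>opfactor 2\<close> twice, and one copy absorbs
  \<open>1 - fps_X\<^sup>2\<close>.\<close>

lemma even_opproduct_nth_nonneg:
  assumes "N \<ge> 2"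
  shows "fps_nth ((even_opproduct N)\<^sup>2 * (1 - fps_X\<^sup>2)) i \<ge> 0"
proof -
  let ?R = "\<Prod>k=3..N. if even k then opfactor k else 1"
  have "{1..N} = insert 1 (insert 2 {3..N})" using assms by auto
  then have "even_opproduct N = opfactor 2 * ?R"
    by (simp add: even_opproduct_def)
  then have "(even_opproduct N)\<^sup>2 * (1 - fps_X\<^sup>2) = opfactor 2 * (opfactor 2 * (1 - fps_X\<^sup>2)) * (?R * ?R)"
    by (simp add: power2_eq_square mult_ac)
  also have "\<dots> = opfactor 2 * (1 + fps_X\<^sup>2) * (?R * ?R)"
    by (simp add: opfactor_mult)
  finally have eq: "(even_opproduct N)\<^sup>2 * (1 - fps_X\<^sup>2) = opfactor 2 * (1 + fps_X\<^sup>2) * (?R * ?R)" .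
  have R: "fps_nth (\<Prod>k\<in>A. if even k then opfactor k else 1) j \<ge> 0"
    if "finite A" "0 \<notin> A" for A j
    using that
    by (induction A arbitrary: j rule: finite_induct)
      (auto intro!: fps_mult_nth_nonneg simp: opfactor_nth)
  show ?thesis
    unfolding eq by (intro fps_mult_nth_nonneg R) (auto simp: opfactor_nth fps_X_power_nth)
qed

lemma SOME_bar_mono_step: "SOME_bar n \<le> SOME_bar (n + 2)"
proof -
  \<comment> \<open>An even bound, as the nonnegativity of \<phi> requires, that covers the
    coefficients \<open>n\<close> and \<open>n + 2\<close>.\<close>
  let ?N = "2 * (n + 2)"
  let ?\<phi> = "signed_opproduct ?N" and ?E = "even_opproduct ?N"
  have "0 \<le> fps_nth (fps_XD ?\<phi> * (?E\<^sup>2 * (1 - fps_X\<^sup>2))) (n + 2)"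
  proof (rule fps_mult_nth_nonneg)
    show "0 \<le> fps_nth (?E\<^sup>2 * (1 - fps_X\<^sup>2)) i" for i
      by (rule even_opproduct_nth_nonneg) simp
    show "0 \<le> fps_nth (fps_XD ?\<phi>) i" if "i \<le> n + 2" for i
      unfolding fps_XD_nth using that by (intro mult_nonneg_nonneg signed_opproduct_nth_nonneg) auto
  qed
  also have "fps_XD ?\<phi> * (?E\<^sup>2 * (1 - fps_X\<^sup>2)) =
      fps_XD ?\<phi> * ?E\<^sup>2 - fps_XD ?\<phi> * ?E\<^sup>2 * fps_X\<^sup>2"
    by (simp add: algebra_simps)
  also have "fps_nth \<dots> (n + 2) = of_int (SOME_bar (n + 2)) - of_int (SOME_bar n)"
    by (simp add: fps_X_power_mult_right_nth SOME_bar_eq[of _ ?N])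
  finally show ?thesis by simp
qed

theorem corollary3p14:
  shows "mono_on {1..} (\<lambda>n::nat. SOME_bar (2 * n)) \<and>
         mono_on {1..} (\<lambda>n::nat. SOME_bar (2 * n - 1))"
proof (intro conjI mono_onI)
  fix r s :: nat
  assume "r \<le> s"
  then show "SOME_bar (2 * r) \<le> SOME_bar (2 * s)"
    using lift_Suc_mono_le[of "\<lambda>n. SOME_bar (2 * n)"] SOME_bar_mono_step by simp
next
  fix r s :: nat
  assume "r \<in> {1..}" "s \<in> {1..}" "r \<le> s"
  \<comment> \<open>Subtraction on \<open>nat\<close> truncates, so the odd arguments are written as
    \<open>2 * m + 1\<close> with \<open>m\<close> one less than the index.\<close>
  then have "SOME_bar (2 * (r - 1) + 1) \<le> SOME_bar (2 * (s - 1) + 1)"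
    using lift_Suc_mono_le[of "\<lambda>n. SOME_bar (2 * n + 1)" "r - 1" "s - 1"]
      SOME_bar_mono_step[of "2 * _ + 1"] by simp
  moreover have "2 * (r - 1) + 1 = 2 * r - 1" "2 * (s - 1) + 1 = 2 * s - 1"
    using \<open>r \<in> {1..}\<close> \<open>s \<in> {1..}\<close> by auto
  ultimately show "SOME_bar (2 * r - 1) \<le> SOME_bar (2 * s - 1)" by simp
qed

end
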